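(* Let $m\ge 2$, $k\ge 0$ be integers and let $\alpha>-1$. Let $\{Y_k^j\}_{j=1}^{d_{k,m}}$ be an orthonormal basis of $M_l^+(k)$. Then for every integer $N\ge 0$, every $1\le j\le d_{k,m}$ and every $x\in\mathbb{R}^m$ with $|x|<1$, the Clifford--Gegenbauer polynomials satisfy the Bonnet formulas $$x\,C_{2N,m}^{\alpha}(Y_k^j)(x)=A_{N}\,C_{2N+1,m}^{\alpha}(Y_k^j)(x)+B_{N}\,C_{2N-1,m}^{\alpha}(Y_k^j)(x),$$ $$x\,C_{2N+1,m}^{\alpha}(Y_k^j)(x)=A'_{N}\,C_{2N+2,m}^{\alpha}(Y_k^j)(x)+B'_{N}\,C_{2N,m}^{\alpha}(Y_k^j)(x),$$ where $$A_N=\frac{-(\alpha+k+\frac m2+N)}{2(\alpha+2N+1)(\alpha+k+\frac m2+2N)},\qquad B_N=\frac{2N(\alpha+2N)}{\alpha+k+\frac m2+2N},$$ $$A'_N=\frac{-(\alpha+N+1)}{2(\alpha+2N+2)(\alpha+k+\frac m2+2N+1)},\qquad B'_N=\frac{2(\alpha+2N+1)(k+\frac m2+N)}{\alpha+k+\frac m2+2N+1},$$ and for $N=0$ (where $B_0=0$) the term $B_0\,C_{-1,m}^{\alpha}(Y_k^j)$ is read as $0$.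
   Context: $\mathbb{R}_m$ is the real Clifford algebra generated by $e_1,\dots,e_m$ with $e_j^2=-1$ and $e_ie_j=-e_je_i$ for $i\neq j$. A point $(x_1,\dots,x_m)\in\mathbb{R}^m$ is identified with the Clifford vector $x=\sum_{j=1}^m e_jx_j$, so $x^2=-|x|^2$; products such as $x\,C(x)$ are Clifford products. The Hermitian conjugation $\lambda\mapsto\bar\lambda$ on $\mathbb{R}_m$ is the real-linear anti-automorphism ($\overline{\lambda\mu}=\bar\mu\bar\lambda$) with $\overline{e_j}=-e_j$. The Dirac operator is $\partial_x f=\sum_{j=1}^m e_j\,\partial f/\partial x_j$ (acting from the left). $M_l^+(k)$ is the set of homogeneous polynomials $Y_k:\mathbb{R}^m\to\mathbb{R}_m$ of degree $k$ that are left monogenic, i.e. $\partial_xY_k=0$; its dimension (as a right Clifford module) is $d_{k,m}=\binom{m+k-2}{k}$. An orthonormal basis $\{Y_k^j\}_{j=1}^{d_{k,m}}$ of $M_l^+(k)$ is one for which $\int_{S^{m-1}}\overline{Y_k^j(\omega)}\,Y_k^{j'}(\omega)\,d\omega=\delta_{jj'}$. For $n\ge0$, $\alpha>-1$ and $Y_k\in M_l^+(k)$, the Clifford--Gegenbauer polynomial is $$C_{n,m}^{\alpha}(Y_k)(x)=(1-|x|^2)^{-\alpha}\,\partial_x^n\big((1-|x|^2)^{\alpha+n}\,Y_k(x)\big).$$ *)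

theory Defs
  imports "HOL-Analysis.Analysis"
begin

section \<open>The real Clifford algebra\<close>

text \<open>
  The generators are indexed by a finite linearly ordered type \<open>'n\<close>, so that \<open>m = CARD('n)\<close>.
  The coordinate at a set \<open>A = {a\<^sub>1 < \<dots> < a\<^sub>r}\<close> is the coefficient of \<open>e\<^sub>A = e\<^bsub>a\<^sub>1\<^esub> \<cdots> e\<^bsub>a\<^sub>r\<^esub>\<close>.
  Norm, topology and integration are those of the Euclidean space \<open>real ^ 'n set\<close>.  The
  library's componentwise product \<open>*\<close> and unit \<open>1\<close> on that type are \<^emph>\<open>not\<close> the Clifford ones;
  only \<open>\<odot>\<close> and \<open>cl_one\<close> are used below.
\<close>

type_synonym 'n clifford = "(real, 'n set) vec"

type_synonym 'n clifford_fun = "(real, 'n) vec \<Rightarrow> 'n clifford"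

definition cl_basis :: "'n::finite set \<Rightarrow> 'n clifford" where
  "cl_basis A = axis A 1"

abbreviation cl_one :: "'n::finite clifford" where
  "cl_one \<equiv> cl_basis {}"

abbreviation cl_gen :: "'n::finite \<Rightarrow> 'n clifford" where
  "cl_gen j \<equiv> cl_basis {j}"

text \<open>
  Sorting the word \<open>e\<^sub>A e\<^sub>B\<close> contributes one factor \<open>-1\<close> for each pair \<open>b < a\<close> (a transposition)
  and one for each pair \<open>b = a\<close> (a square \<open>e\<^sub>a\<^sup>2 = -1\<close>); the word left over is the one of the
  symmetric difference of \<open>A\<close> and \<open>B\<close>.
\<close>

definition cl_sign :: "'n::{finite,linorder} set \<Rightarrow> 'n set \<Rightarrow> real" where
  "cl_sign A B = (\<Prod>a\<in>A. \<Prod>b\<in>B. if b \<le> a then - 1 else 1)"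

definition cl_mult ::
    "'n::{finite,linorder} clifford \<Rightarrow> 'n clifford \<Rightarrow> 'n clifford"  (infixl \<open>\<odot>\<close> 70) where
  "u \<odot> v = (\<Sum>A\<in>UNIV. \<Sum>B\<in>UNIV. (u $ A * v $ B * cl_sign A B) *\<^sub>R cl_basis (sym_diff A B))"

text \<open>
  Reversing the word \<open>e\<^sub>A\<close> and negating each letter gives the inverse of \<open>e\<^sub>A\<close>, and
  \<open>e\<^sub>A e\<^sub>A = cl_sign A A\<close>, whence the sign.
\<close>

definition cl_conj :: "'n::{finite,linorder} clifford \<Rightarrow> 'n clifford" where
  "cl_conj u = (\<chi> A. cl_sign A A * u $ A)"

definition cl_vec :: "real ^ 'n \<Rightarrow> 'n::finite clifford" where
  "cl_vec x = (\<Sum>j\<in>UNIV. (x $ j) *\<^sub>R cl_gen j)"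


subsection \<open>The defining relations\<close>

lemma prod_sym_diff:
  fixes f :: "'a::finite \<Rightarrow> real"
  assumes "\<And>a. f a * f a = 1"
  shows "prod f (sym_diff A B) = prod f A * prod f B"
proof -
  have I: "prod f (A \<inter> B) * prod f (A \<inter> B) = 1"
    by (simp add: assms flip: prod.distrib)
  have A: "prod f A = prod f (A - B) * prod f (A \<inter> B)"
    by (subst prod.union_disjoint[symmetric]) (auto intro: arg_cong[where f = "prod f"])
  have B: "prod f B = prod f (B - A) * prod f (A \<inter> B)"
    by (subst prod.union_disjoint[symmetric]) (auto intro: arg_cong[where f = "prod f"])
  have "prod f (sym_diff A B) = prod f (A - B) * prod f (B - A)"
    by (subst prod.union_disjoint) auto
  also have "\<dots> = prod f (A - B) * prod f (B - A) * (prod f (A \<inter> B) * prod f (A \<inter> B))"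
    by (simp add: I)
  finally show ?thesis
    by (simp only: A B mult_ac)
qed

lemma prod_sign_sq:
  "(\<Prod>b\<in>B. if P b then - 1 else (1::real)) * (\<Prod>b\<in>B. if P b then - 1 else 1) = 1"
  by (subst prod.distrib[symmetric], rule prod.neutral) auto

lemma cl_sign_sym_diff_left: "cl_sign (sym_diff A B) C = cl_sign A C * cl_sign B C"
  unfolding cl_sign_def by (rule prod_sym_diff) (rule prod_sign_sq)

lemma cl_sign_sym_diff_right: "cl_sign A (sym_diff B C) = cl_sign A B * cl_sign A C"
  unfolding cl_sign_def
  by (subst prod_sym_diff) (auto simp: prod.distrib)

lemma cl_sign_sq [simp]: "cl_sign A B * cl_sign A B = 1"
  unfolding cl_sign_def
  by (subst prod.distrib[symmetric], rule prod.neutral) (auto simp: prod_sign_sq)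

lemma cl_sign_simps [simp]: "cl_sign {} A = 1" "cl_sign A {} = 1"
  by (simp_all add: cl_sign_def)

lemma cl_basis_nth [simp]: "cl_basis A $ B = (if A = B then 1 else 0)"
  by (simp add: cl_basis_def axis_def)

lemma cl_expand: "u = (\<Sum>A\<in>UNIV. (u $ A) *\<^sub>R cl_basis A)"
  by (simp add: vec_eq_iff if_distrib cong: if_cong)

lemma bilinear_cl_mult: "bilinear (\<odot>)"
  unfolding bilinear_def
  by (auto intro!: linearI simp: cl_mult_def algebra_simps sum.distrib scaleR_sum_right)

lemma bounded_bilinear_cl_mult: "bounded_bilinear (\<odot>)"
  using bilinear_cl_mult bilinear_conv_bounded_bilinear by blast

interpretation cl_mult: bounded_bilinear "(\<odot>)"
  by (rule bounded_bilinear_cl_mult)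

lemma cl_basis_mult: "cl_basis A \<odot> cl_basis B = cl_sign A B *\<^sub>R cl_basis (sym_diff A B)"
proof -
  have "cl_basis A \<odot> cl_basis B = (\<Sum>A'\<in>UNIV. \<Sum>B'\<in>UNIV.
      if A = A' then if B = B' then cl_sign A B *\<^sub>R cl_basis (sym_diff A B) else 0 else 0)"
    unfolding cl_mult_def by (intro sum.cong) auto
  also have "\<dots> = cl_sign A B *\<^sub>R cl_basis (sym_diff A B)"
    by (simp add: if_distrib[of "\<lambda>x. sum x UNIV"] sum.If_cases)
  finally show ?thesis .
qed

lemma cl_mult_assoc: "(u \<odot> v) \<odot> w = u \<odot> (v \<odot> w)"
proof -
  have basis: "(cl_basis A \<odot> cl_basis B) \<odot> cl_basis C = cl_basis A \<odot> (cl_basis B \<odot> cl_basis C)"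
    for A B C :: "'a set"
  proof -
    have "sym_diff (sym_diff A B) C = sym_diff A (sym_diff B C)"
      by blast
    thus ?thesis
      by (simp add: cl_basis_mult cl_mult.scaleR_left cl_mult.scaleR_right
          cl_sign_sym_diff_left cl_sign_sym_diff_right mult_ac)
  qed
  show ?thesis
    by (subst (1 2) cl_expand[of u], subst (1 2) cl_expand[of v], subst (1 2) cl_expand[of w])
      (simp add: cl_mult.sum_left cl_mult.sum_right cl_mult.scaleR_left cl_mult.scaleR_right basis)
qed

lemma cl_one_mult [simp]: "cl_one \<odot> u = u" "u \<odot> cl_one = u"
  by (subst (1 2) cl_expand[of u],
      simp add: cl_mult.sum_left cl_mult.sum_right cl_mult.scaleR_left cl_mult.scaleR_right
        cl_basis_mult)+

lemma cl_gen_sq: "cl_gen j \<odot> cl_gen j = - cl_one"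
  by (simp add: cl_basis_mult cl_sign_def)

lemma cl_gen_anticommute: "i \<noteq> j \<Longrightarrow> cl_gen i \<odot> cl_gen j = - (cl_gen j \<odot> cl_gen i)"
  by (auto simp: cl_basis_mult cl_sign_def Un_commute)

lemma linear_cl_conj: "linear cl_conj"
  by (intro linearI) (auto simp: cl_conj_def vec_eq_iff algebra_simps)

lemma cl_conj_basis: "cl_conj (cl_basis A) = cl_sign A A *\<^sub>R cl_basis A"
  by (simp add: cl_conj_def vec_eq_iff)

lemma cl_conj_gen: "cl_conj (cl_gen j) = - cl_gen j"
  by (simp add: cl_conj_basis) (simp add: cl_sign_def)

lemma cl_conj_mult: "cl_conj (u \<odot> v) = cl_conj v \<odot> cl_conj u"
proof -
  interpret conj: linear cl_conj by (rule linear_cl_conj)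
  have basis: "cl_conj (cl_basis A \<odot> cl_basis B) = cl_conj (cl_basis B) \<odot> cl_conj (cl_basis A)"
    for A B :: "'a set"
    using cl_sign_sq[of A B]
    by (simp add: cl_basis_mult cl_conj_basis conj.scale cl_mult.scaleR_left cl_mult.scaleR_right
        cl_sign_sym_diff_left cl_sign_sym_diff_right Un_commute mult_ac)
  have "cl_conj (u \<odot> v)
      = cl_conj ((\<Sum>A\<in>UNIV. (u $ A) *\<^sub>R cl_basis A) \<odot> (\<Sum>B\<in>UNIV. (v $ B) *\<^sub>R cl_basis B))"
    by (simp flip: cl_expand)
  also have "\<dots> = cl_conj (\<Sum>B\<in>UNIV. (v $ B) *\<^sub>R cl_basis B) \<odot>
      cl_conj (\<Sum>A\<in>UNIV. (u $ A) *\<^sub>R cl_basis A)"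
    by (simp add: cl_mult.sum_left cl_mult.sum_right cl_mult.scaleR_left cl_mult.scaleR_right
        conj.sum conj.scale basis scaleR_sum_right, subst sum.swap, simp add: mult.commute)
  finally show ?thesis
    by (simp flip: cl_expand)
qed

lemma cl_vec_sq: "cl_vec x \<odot> cl_vec x = - ((norm x)\<^sup>2 *\<^sub>R cl_one)"
proof -
  define f where "f i j = (x $ i * x $ j) *\<^sub>R (cl_gen i \<odot> cl_gen j)" for i j
  have sq: "cl_vec x \<odot> cl_vec x = (\<Sum>i\<in>UNIV. \<Sum>j\<in>UNIV. f i j)"
    by (simp add: cl_vec_def f_def cl_mult.sum_left cl_mult.sum_right cl_mult.scaleR_left
        cl_mult.scaleR_right scaleR_sum_right, subst sum.swap, simp add: mult.commute)
  have sym: "f i j + f j i = (if i = j then - (2 * (x $ i)\<^sup>2) *\<^sub>R cl_one else 0)" for i j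
  proof (cases "i = j")
    case True
    thus ?thesis
      by (simp add: f_def cl_gen_sq power2_eq_square flip: scaleR_left_distrib scaleR_minus_left)
  next
    case False
    thus ?thesis
      by (simp add: f_def cl_gen_anticommute[of i j] mult.commute)
  qed
  have "2 *\<^sub>R (cl_vec x \<odot> cl_vec x)
      = (\<Sum>i\<in>UNIV. \<Sum>j\<in>UNIV. f i j) + (\<Sum>i\<in>UNIV. \<Sum>j\<in>UNIV. f j i)"
    unfolding sq by (subst (3) sum.swap) (simp add: scaleR_2)
  also have "\<dots> = (\<Sum>i\<in>UNIV. - (2 * (x $ i)\<^sup>2) *\<^sub>R cl_one)"
    by (simp only: sum.distrib[symmetric] sym) simp
  also have "\<dots> = 2 *\<^sub>R (- ((norm x)\<^sup>2 *\<^sub>R cl_one))"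
    by (simp add: norm_vec_def L2_set_def sum_nonneg sum_negf sum_distrib_left
        flip: scaleR_left.sum)
  finally show ?thesis
    by (simp only: scaleR_cancel_left) simp
qed


section \<open>The Dirac operator and left monogenic polynomials\<close>

definition partial_deriv ::
    "'n \<Rightarrow> (real ^ 'n \<Rightarrow> 'b::real_normed_vector) \<Rightarrow> real ^ 'n \<Rightarrow> 'b" where
  "partial_deriv j f x = vector_derivative (\<lambda>t. f (x + t *\<^sub>R axis j 1)) (at 0)"

definition dirac ::
    "'n::{finite,linorder} clifford_fun \<Rightarrow> 'n clifford_fun" where
  "dirac f x = (\<Sum>j\<in>UNIV. cl_gen j \<odot> partial_deriv j f x)"

definition homogeneous_polynomial ::
    "nat \<Rightarrow> ('a::real_normed_vector \<Rightarrow> 'b::real_normed_vector) \<Rightarrow> bool" where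
  "homogeneous_polynomial k f \<longleftrightarrow>
     polynomial_function f \<and> (\<forall>t x. f (t *\<^sub>R x) = t ^ k *\<^sub>R f x)"

definition left_monogenic_polys ::
    "nat \<Rightarrow> (real ^ 'n::{finite,linorder} \<Rightarrow> 'n clifford) set" where
  "left_monogenic_polys k = {Y. homogeneous_polynomial k Y \<and> (\<forall>x. dirac Y x = 0)}"


section \<open>Orthonormal bases\<close>

text \<open>
  Surface measure on the unit sphere, not normalised: the measure of \<open>E\<close> is the dimension times
  the Lebesgue measure of the cone \<open>{t *\<^sub>R \<omega> | 0 < t < 1, \<omega> \<in> E}\<close>.
\<close>

definition sphere_measure :: "'a::euclidean_space measure" where
  "sphere_measure = scale_measure (of_nat DIM('a))
     (distr (restrict_space lborel (ball 0 1 - {0})) (restrict_space borel (sphere 0 1))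
       (\<lambda>x. x /\<^sub>R norm x))"

definition sphere_inner ::
    "'n clifford_fun \<Rightarrow> 'n clifford_fun \<Rightarrow> 'n::{finite,linorder} clifford" where
  "sphere_inner f g = (LINT \<omega>|sphere_measure. cl_conj (f \<omega>) \<odot> g \<omega>)"

text \<open>Module scalars act by Clifford multiplication from the right.\<close>

definition right_module_basis ::
    "'i set \<Rightarrow> ('i \<Rightarrow> 'n clifford_fun) \<Rightarrow> 'n::{finite,linorder} clifford_fun set
      \<Rightarrow> bool" where
  "right_module_basis I Y M \<longleftrightarrow>
     Y ` I \<subseteq> M \<and>
     (\<forall>f\<in>M. \<exists>c. \<forall>x. f x = (\<Sum>j\<in>I. Y j x \<odot> c j)) \<and>
     (\<forall>c. (\<forall>x. (\<Sum>j\<in>I. Y j x \<odot> c j) = 0) \<longrightarrow> (\<forall>j\<in>I. c j = 0))"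

definition orthonormal_monogenic_basis ::
    "nat \<Rightarrow> (nat \<Rightarrow> 'n::{finite,linorder} clifford_fun) \<Rightarrow> bool" where
  "orthonormal_monogenic_basis k Y \<longleftrightarrow>
     (let I = {1..(CARD('n) + k - 2) choose k} in
        right_module_basis I Y (left_monogenic_polys k) \<and>
        (\<forall>i\<in>I. \<forall>j\<in>I. sphere_inner (Y i) (Y j) = (if i = j then cl_one else 0)))"


section \<open>Clifford--Gegenbauer polynomials\<close>

text \<open>
  Meaningful on the open unit ball only: there the base of \<open>powr\<close> is positive and, the ball being
  open, the iterated derivatives do not see the values of the weight outside.
\<close>

definition clifford_gegenbauer ::
    "nat \<Rightarrow> real \<Rightarrow> 'n::{finite,linorder} clifford_fun \<Rightarrow> 'n clifford_fun" where
  "clifford_gegenbauer n \<alpha> Y x =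
     (1 - (norm x)\<^sup>2) powr (- \<alpha>) *\<^sub>R
       (dirac ^^ n) (\<lambda>y. (1 - (norm y)\<^sup>2) powr (\<alpha> + real n) *\<^sub>R Y y) x"

end

theory Submission
  imports Defs
begin

text \<open>
  Write \<open>w = 1 - |x|\<^sup>2\<close>, \<open>c = k + m/2\<close> and \<open>\<partial>\<close> for the Dirac operator, so that
  \<open>C\<^sub>n = w\<^bsup>-\<alpha>\<^esup> \<partial>\<^sup>n (w\<^bsup>\<alpha>+n\<^esup> Y)\<close>.  The common factor \<open>w\<^bsup>-\<alpha>\<^esup>\<close> is a real scalar, so the Bonnet formulas
  are statements about how multiplication by \<open>x\<close> passes through \<open>\<partial>\<^sup>n\<close>.

  As \<open>-\<partial>\<^sup>2\<close> is the Laplacian, \<open>\<partial>\<^sup>2 x f = x \<partial>\<^sup>2 f - 2 \<partial> f\<close>, and by iteration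
  \<open>x \<partial>\<^bsup>2N\<^esup> f = \<partial>\<^bsup>2N\<^esup> (x f) + 2N \<partial>\<^bsup>2N-1\<^esup> f\<close> (\<open>cl_vec_dirac_even_power\<close>).  Take \<open>f = w\<^sup>\<beta> Y\<close> with
  \<open>\<beta> = \<alpha> + 2N\<close>, respectively \<open>f = \<partial> (w\<^sup>\<beta> Y)\<close> with \<open>\<beta> = \<alpha> + 2N + 1\<close>.  In the first case
  \<open>x w\<^sup>\<beta> Y\<close> is a multiple of \<open>\<partial> (w\<^bsup>\<beta>+1\<^esup> Y)\<close>; in the second \<open>x f\<close> is a combination of \<open>w\<^bsup>\<beta>-1\<^esup> Y\<close> and
  \<open>w\<^sup>\<beta> Y\<close>.  What does not yet fit the Gegenbauer pattern are derivatives of \<open>w\<^sup>\<beta> Y\<close> itself.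
  These are removed with
  \<open>\<partial>\<^sup>2 (w\<^bsup>\<beta>+1\<^esup> Y) = -4 (\<beta>+1) (\<beta> w\<^bsup>\<beta>-1\<^esup> - (\<beta>+c) w\<^sup>\<beta>) Y\<close>, solved for \<open>w\<^sup>\<beta> Y\<close>
  (\<open>weight_Y_via_dirac_sq\<close>).  Collecting coefficients gives \<open>bonnet_even\<close> and \<open>bonnet_odd\<close>.

  All functions involved, and all their iterated derivatives, lie in the span of the functions
  \<open>w\<^sup>\<beta> Y\<close> and \<open>w\<^sup>\<beta> x Y\<close>, which is stable under \<open>\<partial>\<close> and under multiplication by \<open>x\<close>.  On it \<open>\<partial>\<close> is
  given by two explicit rules, \<open>dirac_even\<close> and \<open>dirac_odd\<close>, and the commutation relation is
  verified on the two families of generators.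
\<close>

section \<open>The Dirac operator on differentiable functions\<close>

lemma partial_deriv_eq:
  assumes "(f has_derivative f') (at x)"
  shows "partial_deriv j f x = f' (axis j 1)"
proof -
  have "((\<lambda>t. x + t *\<^sub>R axis j 1) has_vector_derivative axis j 1) (at (0::real))"
    by (auto intro!: derivative_eq_intros simp: has_vector_derivative_def)
  moreover have "(f has_derivative f') (at (x + 0 *\<^sub>R axis j 1))"
    using assms by simp
  ultimately have "((f \<circ> (\<lambda>t. x + t *\<^sub>R axis j 1)) has_vector_derivative f' (axis j 1)) (at (0::real))"
    unfolding has_vector_derivative_def
    by (auto dest: diff_chain_at[where g = f]
        simp: o_def linear_scale[OF has_derivative_linear[OF assms]])
  then show ?thesis
    by (simp add: partial_deriv_def o_def vector_derivative_at)
qed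

lemma dirac_eq:
  assumes "(f has_derivative f') (at x)"
  shows "dirac f x = (\<Sum>j\<in>UNIV. cl_gen j \<odot> f' (axis j 1))"
  by (simp add: dirac_def partial_deriv_eq[OF assms])

text \<open>
  The radius is fixed to 1 because the weight is only controlled on the open unit ball; all
  identities below are identities of functions on that ball.
\<close>

lemma dirac_cong:
  assumes "\<And>y. norm y < 1 \<Longrightarrow> f y = g y" and "norm x < 1"
  shows "dirac f x = dirac g x"
proof -
  have "partial_deriv j f x = partial_deriv j g x" for j
  proof -
    have "((\<lambda>t. x + t *\<^sub>R axis j 1) \<longlongrightarrow> x + 0 *\<^sub>R axis j 1) (nhds (0::real))"
      by (intro tendsto_intros filterlim_ident)
    then have "\<forall>\<^sub>F t in nhds (0::real). x + t *\<^sub>R axis j 1 \<in> ball 0 1"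
      by (rule topological_tendstoD) (use assms(2) in auto)
    then have "\<forall>\<^sub>F t in nhds 0. f (x + t *\<^sub>R axis j 1) = g (x + t *\<^sub>R axis j 1)"
      by (rule eventually_mono) (simp add: assms(1))
    then show ?thesis
      unfolding partial_deriv_def
      by (intro vector_derivative_cong_eq) auto
  qed
  then show ?thesis
    by (simp add: dirac_def)
qed

lemma dirac_lincomb:
  assumes "f differentiable at x" "g differentiable at x"
  shows "dirac (\<lambda>y. a *\<^sub>R f y + b *\<^sub>R g y) x = a *\<^sub>R dirac f x + b *\<^sub>R dirac g x"
proof -
  obtain f' g' where f: "(f has_derivative f') (at x)" and g: "(g has_derivative g') (at x)"
    using assms unfolding differentiable_def by blast
  have "((\<lambda>y. a *\<^sub>R f y + b *\<^sub>R g y) has_derivative (\<lambda>h. a *\<^sub>R f' h + b *\<^sub>R g' h)) (at x)"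
    by (intro derivative_intros f g)
  then show ?thesis
    by (simp add: dirac_eq[OF f] dirac_eq[OF g] dirac_eq cl_mult.add_right cl_mult.scaleR_right
        sum.distrib scaleR_sum_right)
qed

section \<open>Differentiating weights and homogeneous monogenics\<close>

definition weight :: "real \<Rightarrow> 'a::real_normed_vector \<Rightarrow> real" where
  "weight \<beta> y = (1 - (norm y)\<^sup>2) powr \<beta>"

lemma weight_Suc:
  assumes "norm y < 1"
  shows "(1 - (norm y)\<^sup>2) * weight \<beta> y = weight (\<beta> + 1) y"
proof -
  have "(norm y)\<^sup>2 < 1"
    using assms by (simp add: abs_square_less_1)
  then show ?thesis
    by (simp add: weight_def powr_add)
qed

lemma norm_sq_weight:
  assumes "norm y < 1"
  shows "(norm y)\<^sup>2 * weight \<beta> y = weight \<beta> y - weight (\<beta> + 1) y"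
  using weight_Suc[OF assms, of \<beta>] by (simp add: algebra_simps)

lemma weight_has_derivative:
  fixes x :: "'a::real_inner"
  assumes "norm x < 1"
  shows "(weight \<beta> has_derivative (\<lambda>h. - 2 * \<beta> * weight (\<beta> - 1) x * (x \<bullet> h))) (at x)"
proof -
  have pos: "1 - x \<bullet> x > 0"
    using assms by (simp add: abs_square_less_1 flip: power2_norm_eq_inner)
  have "((\<lambda>y. (1 - y \<bullet> y) powr \<beta>) has_derivative
      (\<lambda>h. - 2 * \<beta> * (1 - x \<bullet> x) powr (\<beta> - 1) * (x \<bullet> h))) (at x)"
    using pos
    by (auto intro!: derivative_eq_intros simp: powr_diff inner_commute field_simps)
  then show ?thesis
    unfolding weight_def power2_norm_eq_inner .
qed

lemma cl_vec_eq_sum_inner: "cl_vec x = (\<Sum>j\<in>UNIV. (x \<bullet> axis j 1) *\<^sub>R cl_gen j)"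
  by (simp add: cl_vec_def inner_axis)

lemma cl_vec_has_derivative: "(cl_vec has_derivative cl_vec) F"
proof -
  have "linear cl_vec"
    by (intro linearI) (auto simp: cl_vec_def algebra_simps sum.distrib scaleR_sum_right)
  then show ?thesis
    by (rule linear_imp_has_derivative)
qed

lemma cl_vec_axis: "cl_vec (axis j 1) = cl_gen j"
  by (simp add: cl_vec_def axis_def if_distrib[of "\<lambda>c. c *\<^sub>R _"] cong: if_cong)

lemma cl_gen_cl_vec: "cl_gen j \<odot> cl_vec x = - (cl_vec x \<odot> cl_gen j) - (2 * x $ j) *\<^sub>R cl_one"
proof -
  have g: "cl_gen j \<odot> cl_gen i + cl_gen i \<odot> cl_gen j = (if i = j then - 2 *\<^sub>R cl_one else 0)" for i
    using cl_gen_anticommute[of i j] by (auto simp: cl_gen_sq scaleR_2)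
  have "cl_gen j \<odot> cl_vec x + cl_vec x \<odot> cl_gen j
      = (\<Sum>i\<in>UNIV. x $ i *\<^sub>R (cl_gen j \<odot> cl_gen i + cl_gen i \<odot> cl_gen j))"
    by (simp add: cl_vec_def cl_mult.sum_left cl_mult.sum_right cl_mult.scaleR_left
        cl_mult.scaleR_right scaleR_add_right sum.distrib)
  also have "\<dots> = - (2 * x $ j) *\<^sub>R cl_one"
    by (simp add: g if_distrib[of "\<lambda>c. _ *\<^sub>R c"] cong: if_cong)
  finally have "cl_gen j \<odot> cl_vec x = - (2 * x $ j) *\<^sub>R cl_one - cl_vec x \<odot> cl_gen j"
    by (simp only: eq_diff_eq)
  then show ?thesis
    by simp
qed

lemma cl_vec_cl_vec_mult: "cl_vec x \<odot> (cl_vec x \<odot> u) = - (norm x)\<^sup>2 *\<^sub>R u"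
  by (simp add: cl_vec_sq cl_mult.minus_left cl_mult.scaleR_left flip: cl_mult_assoc)

lemma dirac_weight_mult:
  assumes "f differentiable at x" and "norm x < 1"
  shows "dirac (\<lambda>y. weight \<beta> y *\<^sub>R f y) x
    = (- 2 * \<beta> * weight (\<beta> - 1) x) *\<^sub>R (cl_vec x \<odot> f x) + weight \<beta> x *\<^sub>R dirac f x"
proof -
  obtain f' where f: "(f has_derivative f') (at x)"
    using assms(1) unfolding differentiable_def by blast
  have "((\<lambda>y. weight \<beta> y *\<^sub>R f y) has_derivative
     (\<lambda>h. weight \<beta> x *\<^sub>R f' h + (- 2 * \<beta> * weight (\<beta> - 1) x * (x \<bullet> h)) *\<^sub>R f x)) (at x)"
    by (intro has_derivative_scaleR weight_has_derivative f assms)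
  note dirac_eq[OF this]
  then show ?thesis
    by (simp add: dirac_eq[OF f] cl_mult.add_right cl_mult.scaleR_right sum.distrib
        cl_vec_eq_sum_inner cl_mult.sum_left cl_mult.scaleR_left scaleR_sum_right sum_subtractf
        sum_negf cl_mult.diff_right)
qed

lemma homogeneous_polynomial_differentiable:
  fixes Y :: "'a::euclidean_space \<Rightarrow> 'b::euclidean_space"
  assumes "homogeneous_polynomial k Y"
  shows "Y differentiable at x"
  using assms differentiable_at_polynomial_function unfolding homogeneous_polynomial_def by blast

text \<open>Differentiate \<open>f (t x) = t\<^sup>k f x\<close> with respect to \<open>t\<close> at \<open>t = 1\<close>.\<close>

lemma euler_homogeneous:
  assumes "\<And>t x. f (t *\<^sub>R x) = t ^ k *\<^sub>R f x"
    and "(f has_derivative f') (at x)"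
  shows "f' x = real k *\<^sub>R f x"
proof -
  have "((\<lambda>t. t *\<^sub>R x) has_derivative (\<lambda>t. t *\<^sub>R x)) (at (1::real))"
    by (auto intro!: derivative_eq_intros)
  moreover have "(f has_derivative f') (at (1 *\<^sub>R x))"
    using assms(2) by simp
  ultimately have "((\<lambda>t. f (t *\<^sub>R x)) has_derivative (\<lambda>t. f' (t *\<^sub>R x))) (at (1::real))"
    by (auto dest: diff_chain_at simp: o_def)
  moreover have "((\<lambda>t. t ^ k *\<^sub>R f x) has_derivative (\<lambda>t. (real k * t) *\<^sub>R f x)) (at (1::real))"
    by (auto intro!: derivative_eq_intros)
  ultimately have "(\<lambda>t. f' (t *\<^sub>R x)) = (\<lambda>t. (real k * t) *\<^sub>R f x)"
    unfolding assms(1) by (rule has_derivative_unique)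
  from fun_cong[OF this, of 1] show ?thesis
    by simp
qed

text \<open>
  Moving \<open>e\<^sub>j\<close> past \<open>x\<close> costs \<open>-2 x\<^sub>j\<close>, so \<open>\<partial> (x Y) = -m Y - x \<partial>Y - 2 \<Sum>\<^sub>j x\<^sub>j \<partial>\<^sub>j Y\<close>.  Here \<open>\<partial>Y\<close> vanishes
  and the last sum is \<open>k Y\<close> by Euler's identity for homogeneous functions.
\<close>

lemma dirac_cl_vec_mult:
  fixes Y :: "'n::{finite,linorder} clifford_fun"
  assumes "Y \<in> left_monogenic_polys k"
  shows "dirac (\<lambda>y. cl_vec y \<odot> Y y) x = - (real CARD('n) + 2 * k) *\<^sub>R Y x"
proof -
  have Y: "homogeneous_polynomial k Y" and mono: "dirac Y x = 0"
    using assms by (auto simp: left_monogenic_polys_def)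
  obtain Y' where Y': "(Y has_derivative Y') (at x)"
    using homogeneous_polynomial_differentiable[OF Y] unfolding differentiable_def by blast
  interpret Y': linear Y' by (rule has_derivative_linear[OF Y'])
  have "((\<lambda>y. cl_vec y \<odot> Y y) has_derivative
      (\<lambda>h. cl_vec x \<odot> Y' h + cl_vec h \<odot> Y x)) (at x)"
    by (intro cl_mult.FDERIV cl_vec_has_derivative Y')
  then have "dirac (\<lambda>y. cl_vec y \<odot> Y y) x
      = (\<Sum>j\<in>UNIV. cl_gen j \<odot> (cl_vec x \<odot> Y' (axis j 1) + cl_gen j \<odot> Y x))"
    by (simp add: dirac_eq cl_vec_axis)
  also have "\<dots> = (\<Sum>j\<in>UNIV. - (cl_vec x \<odot> (cl_gen j \<odot> Y' (axis j 1)))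
      - 2 *\<^sub>R (x $ j *\<^sub>R Y' (axis j 1)) - Y x)"
    by (intro sum.cong)
      (simp_all add: cl_mult.add_right cl_gen_cl_vec cl_gen_sq cl_mult.minus_left
        cl_mult.diff_left cl_mult.scaleR_left flip: cl_mult_assoc)
  also have "\<dots> = - (cl_vec x \<odot> dirac Y x) - 2 *\<^sub>R (\<Sum>j\<in>UNIV. x $ j *\<^sub>R Y' (axis j 1))
      - real CARD('n) *\<^sub>R Y x"
    by (simp add: sum_subtractf sum_negf dirac_eq[OF Y'] cl_mult.sum_right scaleR_sum_right
        sum_constant_scaleR del: sum_constant)
  also have "(\<Sum>j\<in>UNIV. x $ j *\<^sub>R Y' (axis j 1)) = Y' (\<Sum>j\<in>UNIV. x $ j *\<^sub>R axis j 1)"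
    by (simp add: Y'.sum Y'.scale)
  also have "(\<Sum>j\<in>UNIV. x $ j *\<^sub>R axis j 1) = x"
    using basis_expansion[of x] by (simp add: scalar_mult_eq_scaleR)
  also have "Y' x = k *\<^sub>R Y x"
    using Y by (intro euler_homogeneous Y') (auto simp: homogeneous_polynomial_def)
  finally have eq: "dirac (\<lambda>y. cl_vec y \<odot> Y y) x
      = - (cl_vec x \<odot> dirac Y x) - 2 *\<^sub>R (real k *\<^sub>R Y x) - real CARD('n) *\<^sub>R Y x" .
  show ?thesis
    unfolding eq mono by (simp add: cl_mult.zero_right vec_eq_iff algebra_simps)
qed

section \<open>The span of the weighted monogenics\<close>

text \<open>
  Functions are described by their values on the open unit ball only, which makes the predicate
  insensitive to the behaviour of the weight and of \<open>dirac\<close> elsewhere.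
\<close>

inductive weighted_span :: "'n::{finite,linorder} clifford_fun \<Rightarrow> 'n clifford_fun \<Rightarrow> bool"
  for Y where
  even: "(\<And>y. norm y < 1 \<Longrightarrow> f y = weight \<beta> y *\<^sub>R Y y) \<Longrightarrow> weighted_span Y f"
| odd: "(\<And>y. norm y < 1 \<Longrightarrow> f y = weight \<beta> y *\<^sub>R (cl_vec y \<odot> Y y)) \<Longrightarrow> weighted_span Y f"
| lincomb: "weighted_span Y f \<Longrightarrow> weighted_span Y g
    \<Longrightarrow> (\<And>y. norm y < 1 \<Longrightarrow> h y = a *\<^sub>R f y + b *\<^sub>R g y) \<Longrightarrow> weighted_span Y h"

context
  fixes Y :: "'n::{finite,linorder} clifford_fun" and k :: nat
  assumes Y: "Y \<in> left_monogenic_polys k"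
begin

lemma monogenic_differentiable: "Y differentiable at x"
  using Y by (auto simp: left_monogenic_polys_def intro: homogeneous_polynomial_differentiable)

lemma cl_vec_monogenic_differentiable: "(\<lambda>y. cl_vec y \<odot> Y y) differentiable at x"
  using monogenic_differentiable[of x] cl_mult.FDERIV[OF cl_vec_has_derivative]
  unfolding differentiable_def by blast

lemma dirac_even:
  fixes \<beta> :: real
  assumes "norm x < 1"
  shows "dirac (\<lambda>y. weight \<beta> y *\<^sub>R Y y) x
    = (- 2 * \<beta>) *\<^sub>R weight (\<beta> - 1) x *\<^sub>R (cl_vec x \<odot> Y x)"
  using Y by (simp add: dirac_weight_mult[OF monogenic_differentiable assms] left_monogenic_polys_def)

text \<open>
  The product rule yields \<open>x x Y = -|x|\<^sup>2 Y\<close>; writing \<open>|x|\<^sup>2 = 1 - w\<close> absorbs this factor into the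
  weights, so that the result lies in the span again.
\<close>

lemma dirac_odd:
  fixes \<beta> :: real
  assumes "norm x < 1"
  shows "dirac (\<lambda>y. weight \<beta> y *\<^sub>R (cl_vec y \<odot> Y y)) x
    = (2 * \<beta>) *\<^sub>R weight (\<beta> - 1) x *\<^sub>R Y x
      + (- 2 * (\<beta> + k + real CARD('n) / 2)) *\<^sub>R weight \<beta> x *\<^sub>R Y x"
proof -
  have "dirac (\<lambda>y. weight \<beta> y *\<^sub>R (cl_vec y \<odot> Y y)) x
    = (2 * \<beta> * ((norm x)\<^sup>2 * weight (\<beta> - 1) x)) *\<^sub>R Y x
      - (weight \<beta> x * (real CARD('n) + 2 * k)) *\<^sub>R Y x"
    by (simp add: dirac_weight_mult[OF cl_vec_monogenic_differentiable assms] cl_vec_cl_vec_mult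
        dirac_cl_vec_mult[OF Y] vec_eq_iff algebra_simps)
  also have "\<dots> = (2 * \<beta> * (weight (\<beta> - 1) x - weight \<beta> x)) *\<^sub>R Y x
      - (weight \<beta> x * (real CARD('n) + 2 * k)) *\<^sub>R Y x"
    using norm_sq_weight[OF assms, of "\<beta> - 1"] by simp
  also have "\<dots> = (2 * \<beta>) *\<^sub>R weight (\<beta> - 1) x *\<^sub>R Y x
      + (- 2 * (\<beta> + k + real CARD('n) / 2)) *\<^sub>R weight \<beta> x *\<^sub>R Y x"
    by (simp add: vec_eq_iff algebra_simps)
  finally show ?thesis .
qed

lemma weighted_span_differentiable:
  assumes "weighted_span Y f" and "norm x < 1"
  shows "f differentiable at x"
proof -
  have transfer: "f differentiable at x"
    if g: "g differentiable at x" and eq: "\<And>y. norm y < 1 \<Longrightarrow> f y = g y"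
    for f g :: "'n clifford_fun"
  proof -
    obtain D where "(g has_derivative D) (at x)"
      using g unfolding differentiable_def by blast
    then have "(f has_derivative D) (at x)"
      by (rule has_derivative_transform_within_open[of _ _ _ _ "ball 0 1"])
        (use assms(2) eq in auto)
    then show ?thesis
      unfolding differentiable_def by blast
  qed
  have w: "weight \<beta> differentiable at x" for \<beta>
    using weight_has_derivative[OF assms(2)] unfolding differentiable_def by blast
  show ?thesis
    using assms(1)
  proof induction
    case (even f \<beta>)
    show ?case
      by (rule transfer[OF _ even]) (intro differentiable_scaleR w monogenic_differentiable)
  next
    case (odd f \<beta>)
    show ?case
      by (rule transfer[OF _ odd]) (intro differentiable_scaleR w cl_vec_monogenic_differentiable)
  next
    case (lincomb f g h a b)
    show ?case
      by (rule transfer[OF _ lincomb(3)])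
        (intro differentiable_add differentiable_scaleR differentiable_const lincomb)
  qed
qed

lemma dirac_weighted_lincomb:
  assumes "weighted_span Y f" "weighted_span Y g"
    and "\<And>y. norm y < 1 \<Longrightarrow> h y = a *\<^sub>R f y + b *\<^sub>R g y" and "norm x < 1"
  shows "dirac h x = a *\<^sub>R dirac f x + b *\<^sub>R dirac g x"
  using assms dirac_cong[of h "\<lambda>y. a *\<^sub>R f y + b *\<^sub>R g y" x]
  by (simp add: dirac_lincomb weighted_span_differentiable)

lemma weighted_span_even: "weighted_span Y (\<lambda>y. weight \<beta> y *\<^sub>R Y y)"
  by (rule weighted_span.even[of _ \<beta>]) simp

lemma weighted_span_odd: "weighted_span Y (\<lambda>y. weight \<beta> y *\<^sub>R (cl_vec y \<odot> Y y))"
  by (rule weighted_span.odd[of _ \<beta>]) simp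

lemma weighted_span_dirac: "weighted_span Y f \<Longrightarrow> weighted_span Y (dirac f)"
proof (induction rule: weighted_span.induct)
  case (even f \<beta>)
  show ?case
    by (rule weighted_span.lincomb[OF weighted_span_odd[of "\<beta> - 1"] weighted_span_odd,
          where a = "- 2 * \<beta>" and b = 0])
      (simp add: dirac_cong[OF even] dirac_even)
next
  case (odd f \<beta>)
  show ?case
    by (rule weighted_span.lincomb[OF weighted_span_even[of "\<beta> - 1"] weighted_span_even[of \<beta>]])
      (simp only: dirac_cong[OF odd] dirac_odd)
next
  case (lincomb f g h a b)
  show ?case
    by (rule weighted_span.lincomb[OF lincomb.IH]) (rule dirac_weighted_lincomb[OF lincomb.hyps])
qed

lemma weighted_span_dirac_funpow: "weighted_span Y f \<Longrightarrow> weighted_span Y ((dirac ^^ n) f)"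
  by (induction n) (auto intro: weighted_span_dirac)

lemma cl_vec_odd:
  fixes \<beta> :: real
  assumes "norm x < 1"
  shows "cl_vec x \<odot> (weight \<beta> x *\<^sub>R (cl_vec x \<odot> Y x))
    = weight (\<beta> + 1) x *\<^sub>R Y x + - 1 *\<^sub>R (weight \<beta> x *\<^sub>R Y x)"
proof -
  have "cl_vec x \<odot> (weight \<beta> x *\<^sub>R (cl_vec x \<odot> Y x)) = - ((norm x)\<^sup>2 * weight \<beta> x) *\<^sub>R Y x"
    by (simp add: cl_mult.scaleR_right cl_vec_cl_vec_mult mult.commute)
  then show ?thesis
    by (simp add: norm_sq_weight[OF assms] scaleR_left_diff_distrib)
qed

lemma weighted_span_cl_vec: "weighted_span Y f \<Longrightarrow> weighted_span Y (\<lambda>y. cl_vec y \<odot> f y)"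
proof (induction rule: weighted_span.induct)
  case (even f \<beta>)
  show ?case
    by (rule weighted_span.odd[of _ \<beta>]) (simp add: even cl_mult.scaleR_right)
next
  case (odd f \<beta>)
  show ?case
    by (rule weighted_span.lincomb[OF weighted_span_even[of "\<beta> + 1"] weighted_span_even[of \<beta>],
          where a = 1 and b = "- 1"])
      (simp add: odd cl_vec_odd)
next
  case (lincomb f g h a b)
  show ?case
    by (rule weighted_span.lincomb[OF lincomb.IH, of _ a b])
      (simp add: lincomb.hyps(3) cl_mult.add_right cl_mult.scaleR_right)
qed

lemma dirac_funpow_lincomb:
  assumes "weighted_span Y f" "weighted_span Y g"
    and "\<And>y. norm y < 1 \<Longrightarrow> h y = a *\<^sub>R f y + b *\<^sub>R g y" and "norm x < 1"
  shows "(dirac ^^ n) h x = a *\<^sub>R (dirac ^^ n) f x + b *\<^sub>R (dirac ^^ n) g x"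
  using assms(4)
proof (induction n arbitrary: x)
  case (Suc n)
  show ?case
    using dirac_weighted_lincomb[OF weighted_span_dirac_funpow[OF assms(1)]
        weighted_span_dirac_funpow[OF assms(2)] Suc.IH Suc.prems]
    by simp
qed (simp add: assms(3))

lemma dirac_dirac_even:
  fixes \<beta> :: real
  assumes "norm x < 1"
  shows "dirac (dirac (\<lambda>y. weight \<beta> y *\<^sub>R Y y)) x
    = (- 4 * \<beta> * (\<beta> - 1)) *\<^sub>R weight (\<beta> - 2) x *\<^sub>R Y x
      + (4 * \<beta> * (\<beta> - 1 + k + real CARD('n) / 2)) *\<^sub>R weight (\<beta> - 1) x *\<^sub>R Y x"
proof -
  have "dirac (dirac (\<lambda>y. weight \<beta> y *\<^sub>R Y y)) x
    = (- 2 * \<beta>) *\<^sub>R dirac (\<lambda>y. weight (\<beta> - 1) y *\<^sub>R (cl_vec y \<odot> Y y)) x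
      + 0 *\<^sub>R dirac (\<lambda>y. weight \<beta> y *\<^sub>R (cl_vec y \<odot> Y y)) x"
    by (rule dirac_weighted_lincomb[OF weighted_span_odd weighted_span_odd _ assms])
      (simp add: dirac_even)
  also have "\<dots> = (- 2 * \<beta>) *\<^sub>R ((2 * (\<beta> - 1)) *\<^sub>R weight (\<beta> - 2) x *\<^sub>R Y x
      + (- 2 * (\<beta> - 1 + k + real CARD('n) / 2)) *\<^sub>R weight (\<beta> - 1) x *\<^sub>R Y x)"
    by (simp add: dirac_odd[OF assms])
  finally show ?thesis
    by (simp only: scaleR_add_right scaleR_scaleR) (simp add: algebra_simps)
qed

lemma dirac_dirac_odd:
  fixes \<beta> :: real
  assumes "norm x < 1"
  shows "dirac (dirac (\<lambda>y. weight \<beta> y *\<^sub>R (cl_vec y \<odot> Y y))) x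
    = (- 4 * \<beta> * (\<beta> - 1)) *\<^sub>R weight (\<beta> - 2) x *\<^sub>R (cl_vec x \<odot> Y x)
      + (4 * \<beta> * (\<beta> + k + real CARD('n) / 2)) *\<^sub>R weight (\<beta> - 1) x *\<^sub>R (cl_vec x \<odot> Y x)"
proof -
  have "dirac (dirac (\<lambda>y. weight \<beta> y *\<^sub>R (cl_vec y \<odot> Y y))) x
    = (2 * \<beta>) *\<^sub>R dirac (\<lambda>y. weight (\<beta> - 1) y *\<^sub>R Y y) x
      + (- 2 * (\<beta> + k + real CARD('n) / 2)) *\<^sub>R dirac (\<lambda>y. weight \<beta> y *\<^sub>R Y y) x"
    by (rule dirac_weighted_lincomb[OF weighted_span_even weighted_span_even dirac_odd assms])
  then show ?thesis
    by (simp only: dirac_even[OF assms] scaleR_scaleR) (simp add: algebra_simps)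
qed

section \<open>Commuting the position vector with powers of the Dirac operator\<close>

text \<open>
  The relation \<open>[\<partial>\<^sup>2, x] = -2 \<partial>\<close>, that is \<open>[\<Delta>, x] = 2 \<partial>\<close>.  Both sides are linear in \<open>f\<close>, so it
  suffices to compare them on the generators, where they are explicit.
\<close>

lemma dirac_sq_cl_vec:
  assumes "weighted_span Y f" and "norm x < 1"
  shows "dirac (dirac (\<lambda>y. cl_vec y \<odot> f y)) x = cl_vec x \<odot> dirac (dirac f) x - 2 *\<^sub>R dirac f x"
  using assms
proof (induction arbitrary: x rule: weighted_span.induct)
  case (even f \<beta>)
  note x = even(2)
  let ?c = "real k + real CARD('n) / 2"
  let ?u = "cl_vec x \<odot> Y x"
  have sq: "dirac (dirac f) x = dirac (dirac (\<lambda>y. weight \<beta> y *\<^sub>R Y y)) x"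
    by (intro dirac_cong even x)
  have "dirac (dirac (\<lambda>y. cl_vec y \<odot> f y)) x
      = dirac (dirac (\<lambda>y. weight \<beta> y *\<^sub>R (cl_vec y \<odot> Y y))) x"
    by (intro dirac_cong x) (simp add: even cl_mult.scaleR_right)
  moreover have "cl_vec x \<odot> dirac (dirac f) x
      = (- 4 * \<beta> * (\<beta> - 1)) *\<^sub>R weight (\<beta> - 2) x *\<^sub>R ?u
        + (4 * \<beta> * (\<beta> - 1 + ?c)) *\<^sub>R weight (\<beta> - 1) x *\<^sub>R ?u"
    unfolding sq dirac_dirac_even[OF x]
    by (simp only: cl_mult.add_right cl_mult.scaleR_right add.assoc)
  ultimately show ?case
    by (simp only: dirac_dirac_odd[OF x] dirac_cong[OF even(1) x] dirac_even[OF x] scaleR_scaleR)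
      (simp add: vec_eq_iff algebra_simps)
next
  case (odd f \<beta>)
  note x = odd(2)
  define c where "c = real k + real CARD('n) / 2"
  define E where "E \<beta> = (\<lambda>y. weight \<beta> y *\<^sub>R Y y)" for \<beta>
  have span: "weighted_span Y (E \<beta>)" for \<beta>
    unfolding E_def by (rule weighted_span_even)
  have sq: "dirac (dirac f) x = dirac (dirac (\<lambda>y. weight \<beta> y *\<^sub>R (cl_vec y \<odot> Y y))) x"
    by (intro dirac_cong odd x)
  have "dirac (dirac (\<lambda>y. cl_vec y \<odot> f y)) x
      = 1 *\<^sub>R dirac (dirac (E (\<beta> + 1))) x + (- 1) *\<^sub>R dirac (dirac (E \<beta>)) x"
    by (rule dirac_weighted_lincomb[OF weighted_span_dirac weighted_span_dirac
          dirac_weighted_lincomb x], rule span, rule span, rule span, rule span)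
      (simp_all add: E_def odd cl_vec_odd)
  also have "\<dots> = (- 4 * (\<beta> + 1) * \<beta>) *\<^sub>R E (\<beta> - 1) x + (4 * (\<beta> + 1) * (\<beta> + c)) *\<^sub>R E \<beta> x
      - ((- 4 * \<beta> * (\<beta> - 1)) *\<^sub>R E (\<beta> - 2) x + (4 * \<beta> * (\<beta> - 1 + c)) *\<^sub>R E (\<beta> - 1) x)"
    by (simp add: E_def dirac_dirac_even[OF x] c_def add.assoc)
  finally have lhs: "dirac (dirac (\<lambda>y. cl_vec y \<odot> f y)) x = \<dots>" .
  have sq_f: "cl_vec x \<odot> dirac (dirac f) x
      = (- 4 * \<beta> * (\<beta> - 1)) *\<^sub>R (E (\<beta> - 1) x - E (\<beta> - 2) x)
        + (4 * \<beta> * (\<beta> + c)) *\<^sub>R (E \<beta> x - E (\<beta> - 1) x)"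
    unfolding sq dirac_dirac_odd[OF x] cl_mult.add_right
      cl_mult.scaleR_right[of _ "- 4 * \<beta> * (\<beta> - 1)"]
      cl_mult.scaleR_right[of _ "4 * \<beta> * (\<beta> + k + real CARD('n) / 2)"] cl_vec_odd[OF x]
    by (simp add: E_def c_def add.assoc)
  have f: "dirac f x = (2 * \<beta>) *\<^sub>R E (\<beta> - 1) x + (- 2 * (\<beta> + c)) *\<^sub>R E \<beta> x"
    by (simp only: dirac_cong[OF odd(1) x] dirac_odd[OF x] E_def c_def add.assoc)
  show ?case
    unfolding lhs sq_f f by (simp add: vec_eq_iff algebra_simps)
next
  case (lincomb f g h a b)
  note x = lincomb.prems
  note [intro] = lincomb.hyps(1,2) weighted_span_dirac weighted_span_cl_vec
  have "dirac (dirac (\<lambda>y. cl_vec y \<odot> h y)) x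
      = a *\<^sub>R dirac (dirac (\<lambda>y. cl_vec y \<odot> f y)) x + b *\<^sub>R dirac (dirac (\<lambda>y. cl_vec y \<odot> g y)) x"
    by (rule dirac_weighted_lincomb[OF _ _ dirac_weighted_lincomb x])
      (auto simp: lincomb.hyps(3) cl_mult.add_right cl_mult.scaleR_right)
  moreover have "dirac (dirac h) x = a *\<^sub>R dirac (dirac f) x + b *\<^sub>R dirac (dirac g) x"
    by (rule dirac_weighted_lincomb[OF _ _ dirac_weighted_lincomb x]) (auto simp: lincomb.hyps(3))
  moreover have "dirac h x = a *\<^sub>R dirac f x + b *\<^sub>R dirac g x"
    by (rule dirac_weighted_lincomb[OF _ _ _ x]) (auto simp: lincomb.hyps(3))
  ultimately show ?case
    by (simp add: lincomb.IH[OF x] cl_mult.add_right cl_mult.scaleR_right algebra_simps)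
qed

text \<open>For \<open>N = 0\<close> the truncated exponent \<open>2 * N - 1\<close> is harmless because its coefficient vanishes.\<close>

lemma cl_vec_dirac_even_power:
  assumes "weighted_span Y f" and "norm x < 1"
  shows "cl_vec x \<odot> (dirac ^^ (2 * N)) f x
    = (dirac ^^ (2 * N)) (\<lambda>y. cl_vec y \<odot> f y) x + (2 * N) *\<^sub>R (dirac ^^ (2 * N - 1)) f x"
  using assms(2)
proof (induction N arbitrary: x)
  case (Suc N)
  note x = Suc.prems
  define g where "g = (dirac ^^ (2 * N)) f"
  have step: "(dirac ^^ (2 * Suc N)) h = dirac (dirac ((dirac ^^ (2 * N)) h))"
    for h :: "'n clifford_fun"
    by simp
  have odd: "real N *\<^sub>R dirac (dirac ((dirac ^^ (2 * N - 1)) f)) x = real N *\<^sub>R dirac g x"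
    by (cases N) (simp_all add: g_def)
  have g: "weighted_span Y g"
    unfolding g_def by (intro weighted_span_dirac_funpow assms(1))
  note [intro] = assms(1) weighted_span_dirac weighted_span_cl_vec weighted_span_dirac_funpow
  have "dirac (dirac (\<lambda>y. cl_vec y \<odot> g y)) x
      = 1 *\<^sub>R dirac (dirac ((dirac ^^ (2 * N)) (\<lambda>y. cl_vec y \<odot> f y))) x
        + (2 * N) *\<^sub>R dirac (dirac ((dirac ^^ (2 * N - 1)) f)) x"
    by (rule dirac_weighted_lincomb[OF _ _ dirac_weighted_lincomb x])
      (auto simp: g_def Suc.IH)
  moreover have "(2 * N) *\<^sub>R dirac (dirac ((dirac ^^ (2 * N - 1)) f)) x = (2 * N) *\<^sub>R dirac g x"
    using odd by (simp flip: scaleR_scaleR)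
  moreover have "(dirac ^^ (2 * Suc N - 1)) f = dirac g"
    by (simp add: g_def)
  ultimately show ?case
    using dirac_sq_cl_vec[OF g x] unfolding step g_def[symmetric]
    by (simp add: algebra_simps)
qed simp

section \<open>The Bonnet formulas\<close>

text \<open>
  Gegenbauer polynomials of one and the same parameter come from \<open>\<partial>\<^sup>n (w\<^sup>\<gamma> Y)\<close> with a fixed
  difference \<open>\<gamma> - n\<close>.  Both terms on the right have difference \<open>\<beta> - 1\<close>, one less than the left side,
  which is the correction that the commutator term calls for.
\<close>

lemma weight_Y_via_dirac_sq:
  fixes \<beta> :: real
  assumes "norm x < 1" and "\<beta> + 1 \<noteq> 0" and "\<beta> + k + real CARD('n) / 2 \<noteq> 0"
  shows "weight \<beta> x *\<^sub>R Y x
    = (1 / (4 * (\<beta> + 1) * (\<beta> + k + real CARD('n) / 2))) *\<^sub>R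
        (dirac ^^ 2) (\<lambda>y. weight (\<beta> + 1) y *\<^sub>R Y y) x
      + (\<beta> / (\<beta> + k + real CARD('n) / 2)) *\<^sub>R weight (\<beta> - 1) x *\<^sub>R Y x"
proof -
  define d where "d = \<beta> + k + real CARD('n) / 2"
  have d: "d \<noteq> 0"
    using assms(3) by (simp add: d_def)
  have "(dirac ^^ 2) (\<lambda>y. weight (\<beta> + 1) y *\<^sub>R Y y) x
      = (- 4 * (\<beta> + 1) * \<beta>) *\<^sub>R weight (\<beta> - 1) x *\<^sub>R Y x
        + (4 * (\<beta> + 1) * d) *\<^sub>R weight \<beta> x *\<^sub>R Y x"
    using dirac_dirac_even[OF assms(1), of "\<beta> + 1"] by (simp add: numeral_2_eq_2 d_def)
  moreover have "1 / (4 * (\<beta> + 1) * d) * (- 4 * (\<beta> + 1) * \<beta>) = - (\<beta> / d)"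
    and "1 / (4 * (\<beta> + 1) * d) * (4 * (\<beta> + 1) * d) = 1"
    using assms(2) d by (simp_all add: divide_simps) (simp_all add: algebra_simps)
  ultimately show ?thesis
    unfolding d_def[symmetric]
    by (simp only: scaleR_add_right scaleR_scaleR[of "1 / _"]) simp
qed

lemma dirac_funpow_weight_Y:
  fixes \<beta> :: real
  assumes "norm x < 1" and "\<beta> + 1 \<noteq> 0" and "\<beta> + k + real CARD('n) / 2 \<noteq> 0"
  shows "(dirac ^^ n) (\<lambda>y. weight \<beta> y *\<^sub>R Y y) x
    = (1 / (4 * (\<beta> + 1) * (\<beta> + k + real CARD('n) / 2))) *\<^sub>R
        (dirac ^^ (n + 2)) (\<lambda>y. weight (\<beta> + 1) y *\<^sub>R Y y) x
      + (\<beta> / (\<beta> + k + real CARD('n) / 2)) *\<^sub>R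
        (dirac ^^ n) (\<lambda>y. weight (\<beta> - 1) y *\<^sub>R Y y) x"
  unfolding funpow_add o_def
  by (rule dirac_funpow_lincomb[OF weighted_span_dirac_funpow weighted_span_even
        weight_Y_via_dirac_sq[OF _ assms(2,3)] assms(1)])
    (rule weighted_span_even)

text \<open>
  By \<open>cl_vec_dirac_even_power\<close> the left side is \<open>\<partial>\<^bsup>2N\<^esup> (x w\<^sup>\<beta> Y) + 2N \<partial>\<^bsup>2N-1\<^esup> (w\<^sup>\<beta> Y)\<close>.  The first
  term is \<open>-1/(2(\<beta>+1)) \<partial>\<^bsup>2N+1\<^esup> (w\<^bsup>\<beta>+1\<^esup> Y)\<close>; trading the exponent in the second contributes to both
  terms of the result.
\<close>

lemma bonnet_even:
  fixes \<beta> :: real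
  assumes "norm x < 1" and "\<beta> + 1 \<noteq> 0" and "\<beta> + k + real CARD('n) / 2 \<noteq> 0"
  shows "cl_vec x \<odot> (dirac ^^ (2 * N)) (\<lambda>y. weight \<beta> y *\<^sub>R Y y) x
    = (- (\<beta> + k + real CARD('n) / 2 - N) / (2 * (\<beta> + 1) * (\<beta> + k + real CARD('n) / 2))) *\<^sub>R
        (dirac ^^ (2 * N + 1)) (\<lambda>y. weight (\<beta> + 1) y *\<^sub>R Y y) x
      + (real (2 * N) * \<beta> / (\<beta> + k + real CARD('n) / 2)) *\<^sub>R
        (dirac ^^ (2 * N - 1)) (\<lambda>y. weight (\<beta> - 1) y *\<^sub>R Y y) x"
proof -
  define d where "d = \<beta> + k + real CARD('n) / 2"
  have d: "d \<noteq> 0"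
    using assms(3) by (simp add: d_def)
  define E where "E \<beta> = (\<lambda>y. weight \<beta> y *\<^sub>R Y y)" for \<beta>
  have span: "weighted_span Y (E \<beta>)" for \<beta>
    unfolding E_def by (rule weighted_span_even)
  have "(dirac ^^ (2 * N)) (\<lambda>y. cl_vec y \<odot> E \<beta> y) x
      = (- (1 / (2 * (\<beta> + 1)))) *\<^sub>R (dirac ^^ (2 * N)) (dirac (E (\<beta> + 1))) x
        + 0 *\<^sub>R (dirac ^^ (2 * N)) (E \<beta>) x"
  proof (intro dirac_funpow_lincomb weighted_span_dirac span assms(1))
    fix y :: "(real, 'n) vec"
    assume y: "norm y < 1"
    have "- (1 / (2 * (\<beta> + 1))) * (- 2 * (\<beta> + 1)) = 1"
      using assms(2) by (simp add: field_simps)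
    then show "cl_vec y \<odot> E \<beta> y
        = (- (1 / (2 * (\<beta> + 1)))) *\<^sub>R dirac (E (\<beta> + 1)) y + 0 *\<^sub>R E \<beta> y"
      unfolding E_def dirac_even[OF y] scaleR_scaleR[of "- (1 / (2 * (\<beta> + 1)))"]
      by (simp only: cl_mult.scaleR_right) simp
  qed
  then have first: "(dirac ^^ (2 * N)) (\<lambda>y. cl_vec y \<odot> E \<beta> y) x
      = (- (1 / (2 * (\<beta> + 1)))) *\<^sub>R (dirac ^^ (2 * N + 1)) (E (\<beta> + 1)) x"
    by (simp add: funpow_swap1)
  have second: "(2 * N) *\<^sub>R (dirac ^^ (2 * N - 1)) (E \<beta>) x
      = (2 * N / (4 * (\<beta> + 1) * d)) *\<^sub>R (dirac ^^ (2 * N + 1)) (E (\<beta> + 1)) x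
        + (real (2 * N) * \<beta> / d) *\<^sub>R (dirac ^^ (2 * N - 1)) (E (\<beta> - 1)) x"
  proof (cases N)
    case (Suc M)
    have "2 * N - 1 + 2 = 2 * N + 1"
      using Suc by simp
    then show ?thesis
      using dirac_funpow_weight_Y[OF assms, of "2 * N - 1"]
      unfolding E_def d_def[symmetric] by (simp add: scaleR_add_right)
  qed simp
  have coeff: "- (1 / (2 * (\<beta> + 1))) + 2 * N / (4 * (\<beta> + 1) * d) = - (d - N) / (2 * (\<beta> + 1) * d)"
    using assms(2) d by (simp add: divide_simps) (simp add: algebra_simps)
  show ?thesis
    using cl_vec_dirac_even_power[OF span assms(1), of N \<beta>]
    unfolding first second coeff[symmetric] d_def[symmetric] E_def[symmetric]
    by (simp only: scaleR_left_distrib add.assoc)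
qed

text \<open>
  Here one derivative is split off first: \<open>x \<partial> (w\<^sup>\<beta> Y) = 2\<beta> (w\<^bsup>\<beta>-1\<^esup> - w\<^sup>\<beta>) Y\<close>, and the commutator adds
  \<open>2N \<partial>\<^bsup>2N\<^esup> (w\<^sup>\<beta> Y)\<close>, so that \<open>-2 (\<beta> - N)\<close> times \<open>\<partial>\<^bsup>2N\<^esup> (w\<^sup>\<beta> Y)\<close> is left to be traded.
\<close>

lemma bonnet_odd:
  fixes \<beta> :: real
  assumes "norm x < 1" and "\<beta> + 1 \<noteq> 0" and "\<beta> + k + real CARD('n) / 2 \<noteq> 0"
  shows "cl_vec x \<odot> (dirac ^^ (2 * N + 1)) (\<lambda>y. weight \<beta> y *\<^sub>R Y y) x
    = (- (\<beta> - N) / (2 * (\<beta> + 1) * (\<beta> + k + real CARD('n) / 2))) *\<^sub>R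
        (dirac ^^ (2 * N + 2)) (\<lambda>y. weight (\<beta> + 1) y *\<^sub>R Y y) x
      + (2 * \<beta> * (k + real CARD('n) / 2 + N) / (\<beta> + k + real CARD('n) / 2)) *\<^sub>R
        (dirac ^^ (2 * N)) (\<lambda>y. weight (\<beta> - 1) y *\<^sub>R Y y) x"
proof -
  define d where "d = \<beta> + k + real CARD('n) / 2"
  have d: "d \<noteq> 0"
    using assms(3) by (simp add: d_def)
  define E where "E \<beta> = (\<lambda>y. weight \<beta> y *\<^sub>R Y y)" for \<beta>
  have span: "weighted_span Y (E \<beta>)" for \<beta>
    unfolding E_def by (rule weighted_span_even)
  have first: "(dirac ^^ (2 * N)) (\<lambda>y. cl_vec y \<odot> dirac (E \<beta>) y) x
      = (2 * \<beta>) *\<^sub>R (dirac ^^ (2 * N)) (E (\<beta> - 1)) x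
        + (- 2 * \<beta>) *\<^sub>R (dirac ^^ (2 * N)) (E \<beta>) x"
  proof (intro dirac_funpow_lincomb span assms(1))
    fix y :: "(real, 'n) vec"
    assume y: "norm y < 1"
    show "cl_vec y \<odot> dirac (E \<beta>) y = (2 * \<beta>) *\<^sub>R E (\<beta> - 1) y + (- 2 * \<beta>) *\<^sub>R E \<beta> y"
      unfolding E_def dirac_even[OF y] cl_mult.scaleR_right[of _ "- 2 * \<beta>"] cl_vec_odd[OF y]
      by (simp add: algebra_simps)
  qed
  have swap: "(dirac ^^ n) (dirac (E \<beta>)) = (dirac ^^ (n + 1)) (E \<beta>)" for n
    by (simp add: funpow_swap1)
  have second: "real (2 * N) *\<^sub>R (dirac ^^ (2 * N - 1)) (dirac (E \<beta>)) x
      = real (2 * N) *\<^sub>R (dirac ^^ (2 * N)) (E \<beta>) x"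
    unfolding swap by (cases N) simp_all
  have "cl_vec x \<odot> (dirac ^^ (2 * N + 1)) (E \<beta>) x
      = (2 * \<beta>) *\<^sub>R (dirac ^^ (2 * N)) (E (\<beta> - 1)) x
        + (- 2 * (\<beta> - N)) *\<^sub>R (dirac ^^ (2 * N)) (E \<beta>) x"
    using cl_vec_dirac_even_power[OF weighted_span_dirac[OF span] assms(1), of N \<beta>]
    unfolding first second unfolding swap by (simp add: algebra_simps)
  also have "(dirac ^^ (2 * N)) (E \<beta>) x
      = (1 / (4 * (\<beta> + 1) * d)) *\<^sub>R (dirac ^^ (2 * N + 2)) (E (\<beta> + 1)) x
        + (\<beta> / d) *\<^sub>R (dirac ^^ (2 * N)) (E (\<beta> - 1)) x"
    using dirac_funpow_weight_Y[OF assms, of "2 * N"] unfolding E_def d_def .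
  also have "(2 * \<beta>) *\<^sub>R (dirac ^^ (2 * N)) (E (\<beta> - 1)) x
      + (- 2 * (\<beta> - N)) *\<^sub>R ((1 / (4 * (\<beta> + 1) * d)) *\<^sub>R (dirac ^^ (2 * N + 2)) (E (\<beta> + 1)) x
        + (\<beta> / d) *\<^sub>R (dirac ^^ (2 * N)) (E (\<beta> - 1)) x)
    = (- 2 * (\<beta> - N) * (1 / (4 * (\<beta> + 1) * d))) *\<^sub>R (dirac ^^ (2 * N + 2)) (E (\<beta> + 1)) x
      + (2 * \<beta> + - 2 * (\<beta> - N) * (\<beta> / d)) *\<^sub>R (dirac ^^ (2 * N)) (E (\<beta> - 1)) x"
    by (simp only: scaleR_add_right scaleR_left_distrib scaleR_scaleR ac_simps)
  also have "- 2 * (\<beta> - N) * (1 / (4 * (\<beta> + 1) * d)) = - (\<beta> - N) / (2 * (\<beta> + 1) * d)"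
    using assms(2) d by (simp add: divide_simps) (simp add: algebra_simps)
  also have "2 * \<beta> + - 2 * (\<beta> - N) * (\<beta> / d) = 2 * \<beta> * (d - \<beta> + N) / d"
    using d by (simp add: field_simps)
  also have "d - \<beta> + N = k + real CARD('n) / 2 + N"
    by (simp add: d_def)
  finally show ?thesis
    unfolding E_def d_def .
qed

end

lemma clifford_gegenbauer_eq:
  "clifford_gegenbauer n \<alpha> Y x
    = weight (- \<alpha>) x *\<^sub>R (dirac ^^ n) (\<lambda>y. weight (\<alpha> + n) y *\<^sub>R Y y) x"
  by (simp add: clifford_gegenbauer_def weight_def)

lemma scaled_recurrence:
  assumes "u \<odot> p = a *\<^sub>R q + b *\<^sub>R r"
  shows "u \<odot> (w *\<^sub>R p) = a *\<^sub>R (w *\<^sub>R q) + b *\<^sub>R (w *\<^sub>R r)"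
  by (simp add: assms cl_mult.scaleR_right scaleR_add_right mult.commute)

theorem mainTheorem1:
  fixes Y :: "nat \<Rightarrow> 'n::{finite,linorder} clifford_fun"
    and \<alpha> :: real and k N j :: nat and x :: "(real, 'n) vec"
  assumes "CARD('n) \<ge> 2"
    and "\<alpha> > - 1"
    and "orthonormal_monogenic_basis k Y"
    and "j \<in> {1..(CARD('n) + k - 2) choose k}"
    and "norm x < 1"
  shows "let m = real CARD('n);
             C = (\<lambda>n. clifford_gegenbauer n \<alpha> (Y j) x);
             A = - (\<alpha> + k + m / 2 + N) / (2 * (\<alpha> + 2 * N + 1) * (\<alpha> + k + m / 2 + 2 * N));
             B = 2 * N * (\<alpha> + 2 * N) / (\<alpha> + k + m / 2 + 2 * N);
             A' = - (\<alpha> + N + 1) / (2 * (\<alpha> + 2 * N + 2) * (\<alpha> + k + m / 2 + 2 * N + 1));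
             B' = 2 * (\<alpha> + 2 * N + 1) * (k + m / 2 + N) / (\<alpha> + k + m / 2 + 2 * N + 1)
         in cl_vec x \<odot> C (2 * N)
              = A *\<^sub>R C (2 * N + 1) + (if N = 0 then 0 else B *\<^sub>R C (2 * N - 1)) \<and>
            cl_vec x \<odot> C (2 * N + 1) = A' *\<^sub>R C (2 * N + 2) + B' *\<^sub>R C (2 * N)"
proof -
  let ?m = "real CARD('n)"
  have Y: "Y j \<in> left_monogenic_polys k"
    using assms(3,4)
    by (auto simp: orthonormal_monogenic_basis_def right_module_basis_def Let_def)
  have "\<alpha> + 2 * N + 1 \<noteq> 0" "\<alpha> + 2 * N + k + ?m / 2 \<noteq> 0"
    using assms(1,2) by linarith+
  note even = scaled_recurrence[OF bonnet_even[OF Y assms(5) this, of N], of "weight (- \<alpha>) x"]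
  have "\<alpha> + (2 * N + 1) + 1 \<noteq> 0" "\<alpha> + (2 * N + 1) + k + ?m / 2 \<noteq> 0"
    using assms(1,2) by linarith+
  note odd = scaled_recurrence[OF bonnet_odd[OF Y assms(5) this, of N], of "weight (- \<alpha>) x"]
  have "cl_vec x \<odot> clifford_gegenbauer (2 * N) \<alpha> (Y j) x
      = (- (\<alpha> + k + ?m / 2 + N) / (2 * (\<alpha> + 2 * N + 1) * (\<alpha> + k + ?m / 2 + 2 * N))) *\<^sub>R
          clifford_gegenbauer (2 * N + 1) \<alpha> (Y j) x
        + (if N = 0 then 0 else (2 * N * (\<alpha> + 2 * N) / (\<alpha> + k + ?m / 2 + 2 * N)) *\<^sub>R
            clifford_gegenbauer (2 * N - 1) \<alpha> (Y j) x)"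
  proof -
    have e: "\<alpha> + 2 * N + k + ?m / 2 = \<alpha> + k + ?m / 2 + 2 * N"
      "\<alpha> + k + ?m / 2 + 2 * N - N = \<alpha> + k + ?m / 2 + N"
      by simp_all
    have up: "weight (\<alpha> + 2 * N + 1) = weight (\<alpha> + real (2 * N + 1))"
      by (rule arg_cong[where f = weight]) simp
    show ?thesis
    proof (cases "N = 0")
      case True
      then show ?thesis
        using even unfolding e up clifford_gegenbauer_eq by simp
    next
      case False
      then have "\<alpha> + 2 * N - 1 = \<alpha> + real (2 * N - 1)"
        by (simp add: of_nat_diff)
      then have down: "weight (\<alpha> + 2 * N - 1) = weight (\<alpha> + real (2 * N - 1))"
        by (rule arg_cong)
      show ?thesis
        using even unfolding e up down clifford_gegenbauer_eq if_not_P[OF False] .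
    qed
  qed
  moreover have "cl_vec x \<odot> clifford_gegenbauer (2 * N + 1) \<alpha> (Y j) x
      = (- (\<alpha> + N + 1) / (2 * (\<alpha> + 2 * N + 2) * (\<alpha> + k + ?m / 2 + 2 * N + 1))) *\<^sub>R
          clifford_gegenbauer (2 * N + 2) \<alpha> (Y j) x
        + (2 * (\<alpha> + 2 * N + 1) * (k + ?m / 2 + N) / (\<alpha> + k + ?m / 2 + 2 * N + 1)) *\<^sub>R
          clifford_gegenbauer (2 * N) \<alpha> (Y j) x"
  proof -
    have w: "weight (\<alpha> + (2 * N + 1) + 1) = weight (\<alpha> + real (2 * N + 2))"
      "weight (\<alpha> + (2 * N + 1) - 1) = weight (\<alpha> + real (2 * N))"
      by (rule arg_cong[where f = weight], simp)+
    have e: "\<alpha> + (2 * N + 1) - N = \<alpha> + N + 1"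
      "\<alpha> + (2 * N + 1) + 1 = \<alpha> + 2 * N + 2"
      "2 * (\<alpha> + (2 * N + 1)) = 2 * (\<alpha> + 2 * N + 1)"
      "\<alpha> + (2 * N + 1) + k + ?m / 2 = \<alpha> + k + ?m / 2 + 2 * N + 1"
      by simp_all
    show ?thesis
      using odd unfolding w unfolding e clifford_gegenbauer_eq .
  qed
  ultimately show ?thesis
    unfolding Let_def by blast
qed

end
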